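(* Let $C^*$ be the optimal classifier obtained from multi-class minimax training $\Psi^+(G,C)$. At the equilibrium point, maximizing the generator's self-supervised task $\Phi^+(G,C^* )$ is equal to maximizing $$\Phi^+(G,C^* ) = -\frac{1}{K}\left[\sum_{k=1}^{K}\mathrm{KL}\big(P_g^{T_k}\,\|\,P_d^{T_k}\big)\right] + \frac{1}{K}\sum_{k=1}^{K}\left[\mathbb{E}_{\mathbf{x}\sim P_g^{T_k}}\log\left(\frac{p_d^{T_k}(\mathbf{x})}{\sum_{j=1}^{K}p_d^{T_j}(\mathbf{x})}\right)\right].$$
   Context: $\mathcal{T}=\{T_1,\dots,T_K\}$ is a set of image transformations, each applied with equal probability $p(T_k)=1/K$ (concretely $K=4$ and $T_1,\dots,T_4$ are image rotations by $0,90,180,270$ degrees). $P_d$ is the distribution of real data and $P_g$ the distribution induced by the generator $G$. For $\bullet\in\{d,g\}$, $P_\bullet^{T_k}$ is the distribution of samples of $P_\bullet$ transformed by $T_k$, with probability density $p_\bullet^{T_k}(\mathbf{x})$, and $P_\bullet^T$ is the mixture distribution of the transformed samples (over $T_k\in\mathcal{T}$), with density $p_\bullet^T(\mathbf{x})$. A classifier $C$ has softmax outputs $C_1(\mathbf{x}),\dots,C_{K+1}(\mathbf{x})$ with $\sum_{k=1}^{K+1} C_k(\mathbf{x})=1$ for all $\mathbf{x}$; the first $K$ classes are the transformed real samples and class $K+1$ is the fake class. $\mathrm{KL}(P\|Q)=\int p\log(p/q)\,d\mathbf{x}$ is the Kullback–Leibler divergence. A GAN with discriminator $D$, generator $G$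 and classifier $C$ is trained with the objectives $$\max_{D,C}\ \mathcal{V}(D,G)+\lambda_d\Psi^+(G,C),\qquad \min_G\ \mathcal{V}(D,G)-\lambda_g\Phi^+(G,C),$$ where $\lambda_d,\lambda_g$ are constants and $\mathcal{V}(D,G)$ is the GAN value function, e.g. $\mathbb{E}_{\mathbf{x}\sim P_d}\log D(\mathbf{x})+\mathbb{E}_{\mathbf{x}\sim P_g}\log(1-D(\mathbf{x}))$ or an improved version of it. The self-supervised tasks, which form a multi-class minimax game, are $$\Psi^+(G,C)=\mathbb{E}_{\mathbf{x}\sim P_d^T}\mathbb{E}_{T_k\sim\mathcal{T}}\log C_k(\mathbf{x})+\mathbb{E}_{\mathbf{x}\sim P_g^T}\mathbb{E}_{T_k\sim\mathcal{T}}\log C_{K+1}(\mathbf{x}),$$ $$\Phi^+(G,C)=\mathbb{E}_{\mathbf{x}\sim P_g^T}\mathbb{E}_{T_k\sim\mathcal{T}}\log C_k(\mathbf{x})-\mathbb{E}_{\mathbf{x}\sim P_g^T}\mathbb{E}_{T_k\sim\mathcal{T}}\log C_{K+1}(\mathbf{x}).$$ Here $\mathbb{E}_{\mathbf{x}\sim P_\bullet^T}\mathbb{E}_{T_k\sim\mathcal{T}}(\cdot)$ means $\int p_\bullet^T(\mathbf{x})\sum_{k=1}^K p(T_k\mid\mathbf{x})(\cdot)\,d\mathbf{x}$, with $p(T_k\mid\mathbf{x})$ the probability that the sample $\mathbf{x}$ of the mixture belongs to class $T_k$ (i.e. that $T_k$ is the transformation applied to obtain it). All networks $D,G,C$ are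 assumed to have enough capacity. The optimal classifier $C^*$ is the maximizer over $C$ of the discriminator objective, equivalently of $\Psi^+(G,C)$, for the given $G$.
   Formalization: "At the equilibrium point" is made precise as: the class probabilities p(T_k|x) of the real and generated mixtures agree almost everywhere where both mixture densities are positive, for every generator considered; the identity fails for general G without this, and P_g = P_d implies it. *)

theory Defs
  imports "HOL-Probability.Probability"
begin

text \<open>
  Images are points of a Euclidean space. The transformations are \<open>T 1, \<dots>, T K\<close>, and \<open>p k\<close> denotes
  the Lebesgue density of the law of \<open>T k x\<close> for \<open>x\<close> drawn from \<open>P\<close>.
\<close>

definition transformed_densities ::
  "nat \<Rightarrow> (nat \<Rightarrow> 'a::euclidean_space \<Rightarrow> 'a) \<Rightarrow> 'a measure \<Rightarrow> (nat \<Rightarrow> 'a \<Rightarrow> real) \<Rightarrow> bool" where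
  "transformed_densities K T P p \<longleftrightarrow>
     prob_space P \<and> sets P = sets borel \<and>
     (\<forall>k\<in>{1..K}. (\<forall>x. 0 \<le> p k x) \<and> distributed P lborel (T k) (\<lambda>x. ennreal (p k x)))"

definition mixture_density :: "nat \<Rightarrow> (nat \<Rightarrow> 'a \<Rightarrow> real) \<Rightarrow> 'a \<Rightarrow> real" where
  "mixture_density K p x = (\<Sum>k=1..K. (1 / real K) * p k x)"

text \<open>
  Conditional probability, by Bayes' rule with uniform prior, that \<open>T k\<close> produced the sample \<open>x\<close> of
  the mixture. Where the mixture density vanishes the value is the junk value 0; it is only used
  multiplied by that density.
\<close>

definition posterior :: "nat \<Rightarrow> (nat \<Rightarrow> 'a \<Rightarrow> real) \<Rightarrow> nat \<Rightarrow> 'a \<Rightarrow> real" where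
  "posterior K p k x = (1 / real K) * p k x / mixture_density K p x"

text \<open>
  All logarithms whose expectations occur below are taken of numbers in \<open>[0, 1]\<close>, so the expectations
  are well defined in \<open>[-\<infinity>, 0]\<close> once \<open>log 0\<close> is read as \<open>-\<infinity>\<close> (whereas \<open>ln 0 = 0\<close> in the library).
  Using the Bochner integral instead would assign the value 0, the largest possible one, to
  classifiers with divergent log-likelihood.
\<close>

definition neg_log :: "real \<Rightarrow> ennreal" where
  "neg_log t = (if t \<le> 0 then \<infinity> else ennreal (- ln t))"

definition expect_log :: "'a measure \<Rightarrow> ('a \<Rightarrow> real) \<Rightarrow> ereal" where
  "expect_log P f = - enn2ereal (\<integral>\<^sup>+x. neg_log (f x) \<partial>P)"

text \<open>The nested expectation over a mixture sample and then over the class it belongs to, of \<open>log (c k x)\<close>.\<close>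

definition mixture_expect_log ::
  "nat \<Rightarrow> (nat \<Rightarrow> 'a::euclidean_space \<Rightarrow> real) \<Rightarrow> (nat \<Rightarrow> 'a \<Rightarrow> real) \<Rightarrow> ereal" where
  "mixture_expect_log K p c =
     - enn2ereal (\<integral>\<^sup>+x. ennreal (mixture_density K p x) *
                        (\<Sum>k=1..K. ennreal (posterior K p k x) * neg_log (c k x)) \<partial>lborel)"

text \<open>
  Outputs equal to 0 are allowed (the closure of the softmax range): otherwise no optimal classifier
  exists as soon as the transformed densities have different supports. The supremum of the objective
  is the same, and an optimum among strictly positive classifiers is also one here.
\<close>

definition classifier :: "nat \<Rightarrow> (nat \<Rightarrow> 'a::euclidean_space \<Rightarrow> real) \<Rightarrow> bool" where
  "classifier K C \<longleftrightarrow>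
     (\<forall>k\<in>{1..K+1}. C k \<in> borel_measurable borel \<and> (\<forall>x. 0 \<le> C k x)) \<and>
     (\<forall>x. (\<Sum>k=1..K+1. C k x) = 1)"

definition Psi_plus ::
  "nat \<Rightarrow> (nat \<Rightarrow> 'a::euclidean_space \<Rightarrow> real) \<Rightarrow> (nat \<Rightarrow> 'a \<Rightarrow> real) \<Rightarrow> (nat \<Rightarrow> 'a \<Rightarrow> real) \<Rightarrow> ereal" where
  "Psi_plus K pd pg C =
     mixture_expect_log K pd (\<lambda>k. C k) + mixture_expect_log K pg (\<lambda>k. C (K + 1))"

definition Phi_plus ::
  "nat \<Rightarrow> (nat \<Rightarrow> 'a::euclidean_space \<Rightarrow> real) \<Rightarrow> (nat \<Rightarrow> 'a \<Rightarrow> real) \<Rightarrow> ereal" where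
  "Phi_plus K pg C =
     mixture_expect_log K pg (\<lambda>k. C k) - mixture_expect_log K pg (\<lambda>k. C (K + 1))"

definition optimal_classifier ::
  "nat \<Rightarrow> (nat \<Rightarrow> 'a::euclidean_space \<Rightarrow> real) \<Rightarrow> (nat \<Rightarrow> 'a \<Rightarrow> real) \<Rightarrow> (nat \<Rightarrow> 'a \<Rightarrow> real) \<Rightarrow> bool" where
  "optimal_classifier K pd pg C \<longleftrightarrow> is_arg_max (Psi_plus K pd pg) (classifier K) C"

text \<open>
  \<open>KL(P \<parallel> Q)\<close> with values in \<open>[0, \<infinity>]\<close>. The library's \<open>KL_divergence b Q P\<close> takes the reference measure
  first and is meaningful only in the first case. For probability measures the negative part of the
  integrand is always integrable, so non-integrability means that the divergence is infinite.
\<close>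

definition KL :: "'a measure \<Rightarrow> 'a measure \<Rightarrow> ereal" where
  "KL P Q = (if absolutely_continuous Q P \<and> integrable P (entropy_density (exp 1) Q P)
             then ereal (KL_divergence (exp 1) Q P) else \<infinity>)"

definition KL_objective ::
  "nat \<Rightarrow> (nat \<Rightarrow> 'a::euclidean_space \<Rightarrow> 'a) \<Rightarrow> 'a measure \<Rightarrow> (nat \<Rightarrow> 'a \<Rightarrow> real) \<Rightarrow> 'a measure \<Rightarrow> ereal" where
  "KL_objective K T Pd pd Pg =
     - (ereal (1 / real K) * (\<Sum>k=1..K. KL (distr Pg lborel (T k)) (distr Pd lborel (T k))))
     + ereal (1 / real K) *
         (\<Sum>k=1..K. expect_log (distr Pg lborel (T k)) (\<lambda>x. pd k x / (\<Sum>j=1..K. pd j x)))"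

text \<open>
  Agreement of the class posteriors \<open>p(T\<^sub>k | x)\<close> of the real and the generated mixture, wherever both
  are defined. It is the only consequence of being at equilibrium (\<open>P\<^sub>g = P\<^sub>d\<close>) that is needed, and it
  does not force \<open>P\<^sub>g = P\<^sub>d\<close>, so the KL terms need not vanish.
\<close>

definition posteriors_agree ::
  "nat \<Rightarrow> (nat \<Rightarrow> 'a::euclidean_space \<Rightarrow> real) \<Rightarrow> (nat \<Rightarrow> 'a \<Rightarrow> real) \<Rightarrow> bool" where
  "posteriors_agree K pd pg \<longleftrightarrow>
     (AE x in lborel. mixture_density K pd x > 0 \<and> mixture_density K pg x > 0 \<longrightarrow>
        (\<forall>k\<in>{1..K}. posterior K pg k x = posterior K pd k x))"

lemma posteriors_agree_if_same_distribution:
  assumes "transformed_densities K T P p" and "transformed_densities K T P p'"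
  shows "posteriors_agree K p p'"
proof -
  interpret prob_space P using assms by (simp add: transformed_densities_def)
  have "AE x in lborel. \<forall>k\<in>{1..K}. p k x = p' k x"
  proof (rule AE_finite_allI)
    fix k assume k: "k \<in> {1..K}"
    have "AE x in lborel. ennreal (p k x) = ennreal (p' k x)"
      using assms k by (intro distributed_unique) (auto simp: transformed_densities_def)
    then show "AE x in lborel. p k x = p' k x"
      using assms k by (auto simp: transformed_densities_def)
  qed simp
  then show ?thesis
    unfolding posteriors_agree_def
    by (rule AE_mp) (auto intro!: AE_I2 simp: posterior_def mixture_density_def)
qed

end

theory Submission
  imports Defs
begin

text \<open>
  Up to the factor \<open>1 / K\<close>, the objective \<open>\<Psi>\<^sup>+\<close> is minus the integral of the cross entropy between the
  weights \<open>pd 1 x, \<dots>, pd K x, R x\<close> and the outputs \<open>C 1 x, \<dots>, C (K + 1) x\<close>, where \<open>R\<close> is the sum of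
  the \<open>pg k\<close> and \<open>D\<close> that of the \<open>pd k\<close>. The minimum is finite, so the equality case of Gibbs' inequality
  forces \<open>C k = pd k / (D + R)\<close> and \<open>C (K + 1) = R / (D + R)\<close> almost everywhere. Since
  \<open>pg k / R = pd k / D\<close>, this gives
  \<open>pg k * ln (pg k / pd k) = pg k * ln (C (K + 1)) + pg k * ln (pd k / D) - pg k * ln (C k)\<close>,
  where the first two terms on the right are integrable. Hence either everything is finite and the
  identity can be integrated, or some KL divergence is infinite and both sides are \<open>-\<infinity>\<close>.
\<close>

section \<open>Gibbs' inequality for finite unnormalized weights\<close>

definition cross_entropy :: "'i set \<Rightarrow> ('i \<Rightarrow> real) \<Rightarrow> ('i \<Rightarrow> real) \<Rightarrow> ennreal" where
  "cross_entropy I w c = (\<Sum>i\<in>I. ennreal (w i) * neg_log (c i))"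

lemma neg_log_measurable [measurable]: "neg_log \<in> borel_measurable borel"
  unfolding neg_log_def by measurable

text \<open>This is \<open>ln t \<le> t - 1\<close> at \<open>t = S * c / w\<close>, multiplied by
  \<open>w\<close>; equality there forces \<open>t = 1\<close>. The bound is linear in
  \<open>w\<close> and \<open>c\<close> so that it cancels on summation. For \<open>w = 0\<close>
  the inequality reduces to \<open>0 \<le> S * c\<close>, with equality only at
  \<open>c = 0\<close>.\<close>

lemma gibbs_term:
  fixes w c S :: real
  assumes "0 \<le> w" "0 \<le> c" "0 < S" "0 < w \<longrightarrow> 0 < c"
  shows "w - S * c \<le> w * (ln (w / S) - ln c)"
    and "w * (ln (w / S) - ln c) = w - S * c \<Longrightarrow> c = w / S"
proof -
  have *: "w - S * c \<le> w * (ln (w / S) - ln c) \<and>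
     (w * (ln (w / S) - ln c) = w - S * c \<longrightarrow> c = w / S)"
  proof (cases "w = 0")
    case True
    then show ?thesis using assms by auto
  next
    case False
    with assms have pos: "0 < w" "0 < c" by auto
    define t where "t = S * c / w"
    have t: "0 < t" using pos assms by (simp add: t_def)
    have "ln (w / S) - ln c = - ln t"
      using pos assms by (simp add: t_def ln_div ln_mult)
    moreover have "w - S * c = w * (1 - t)"
      using pos by (simp add: t_def field_simps)
    moreover have "ln t \<le> t - 1" using t by (rule ln_le_minus_one)
    moreover have "c = w / S" if "ln t = t - 1"
    proof -
      have "S * c = w" using ln_eq_minus_one[OF t that] pos by (simp add: t_def)
      then show ?thesis using assms by auto
    qed
    moreover have "w * (1 - t) \<le> w * - ln t \<longleftrightarrow> 1 - t \<le> - ln t"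
      using pos by (intro mult_le_cancel_left_pos)
    moreover have "w * - ln t = w * (1 - t) \<longleftrightarrow> - ln t = 1 - t"
      using pos by (subst mult_cancel_left) auto
    ultimately show ?thesis by (metis minus_diff_eq neg_le_iff_le add.inverse_inverse)
  qed
  then show "w - S * c \<le> w * (ln (w / S) - ln c)"
    and "w * (ln (w / S) - ln c) = w - S * c \<Longrightarrow> c = w / S" by auto
qed

lemma prob_vector_le_1:
  assumes "finite I" "\<And>i. i \<in> I \<Longrightarrow> 0 \<le> (c i :: real)" "(\<Sum>i\<in>I. c i) = 1" "i \<in> I"
  shows "c i \<le> 1"
  using member_le_sum[of i I c] assms by auto

context
  fixes I :: "'i set" and w c :: "'i \<Rightarrow> real"
  assumes finite: "finite I" and w_nonneg: "\<And>i. i \<in> I \<Longrightarrow> 0 \<le> w i"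
    and c_nonneg: "\<And>i. i \<in> I \<Longrightarrow> 0 \<le> c i" and c_sum: "(\<Sum>i\<in>I. c i) = 1"
begin

lemma cross_entropy_eq_top:
  assumes "i \<in> I" "0 < w i" "c i = 0"
  shows "cross_entropy I w c = \<infinity>"
proof -
  have "\<infinity> = ennreal (w i) * neg_log (c i)"
    using assms by (simp add: neg_log_def ennreal_mult_top)
  also have "\<dots> \<le> cross_entropy I w c"
    unfolding cross_entropy_def using assms finite by (intro member_le_sum) auto
  finally show ?thesis by (simp add: top_unique)
qed

lemma cross_entropy_real:
  assumes "\<And>i. i \<in> I \<Longrightarrow> 0 < w i \<Longrightarrow> 0 < c i"
  shows "cross_entropy I w c = ennreal (\<Sum>i\<in>I. - (w i * ln (c i)))"
    and "0 \<le> (\<Sum>i\<in>I. - (w i * ln (c i)))"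
proof -
  have nn: "0 \<le> - (w i * ln (c i))" if "i \<in> I" for i
    using assms[OF that] w_nonneg[OF that] prob_vector_le_1[OF finite c_nonneg c_sum that]
    by (cases "w i = 0") (auto simp: mult_nonneg_nonpos)
  have "cross_entropy I w c = (\<Sum>i\<in>I. ennreal (- (w i * ln (c i))))"
    unfolding cross_entropy_def
  proof (rule sum.cong)
    fix i assume i: "i \<in> I"
    show "ennreal (w i) * neg_log (c i) = ennreal (- (w i * ln (c i)))"
    \<comment> \<open>The product \<open>0 * \<infinity>\<close> is 0 in \<open>ennreal\<close>, so
      a class of weight 0 contributes nothing even if its output is 0.\<close>
    proof (cases "w i = 0")
      case False
      then have "0 < w i" "0 < c i" using w_nonneg[OF i] assms[OF i] by auto
      then show ?thesis using prob_vector_le_1[OF finite c_nonneg c_sum i]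
        by (simp add: neg_log_def ennreal_mult[symmetric])
    qed simp
  qed simp
  then show "cross_entropy I w c = ennreal (\<Sum>i\<in>I. - (w i * ln (c i)))"
    using nn by (simp add: sum_ennreal)
  show "0 \<le> (\<Sum>i\<in>I. - (w i * ln (c i)))"
    using nn by (rule sum_nonneg)
qed

end

text \<open>Summing \<open>gibbs_term\<close> cancels the linear parts, because the
  \<open>w i\<close> and the \<open>S * c i\<close> both total \<open>S\<close>. Equality of the
  sums makes each termwise gap vanish, which fixes \<open>c i\<close> also at indices of weight
  0.\<close>

lemma gibbs:
  fixes w c :: "'i \<Rightarrow> real"
  assumes fin: "finite I" and w: "\<And>i. i \<in> I \<Longrightarrow> 0 \<le> w i"
    and c: "\<And>i. i \<in> I \<Longrightarrow> 0 \<le> c i" "(\<Sum>i\<in>I. c i) = 1"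
    and S: "S = (\<Sum>i\<in>I. w i)" "0 < S"
  shows "cross_entropy I w (\<lambda>i. w i / S) \<le> cross_entropy I w c"
    and "cross_entropy I w c \<le> cross_entropy I w (\<lambda>i. w i / S) \<Longrightarrow> i \<in> I \<Longrightarrow> c i = w i / S"
proof -
  have q: "\<And>i. i \<in> I \<Longrightarrow> 0 \<le> w i / S" "(\<Sum>i\<in>I. w i / S) = 1"
    using w S by (auto simp: sum_divide_distrib[symmetric])
  have Q: "cross_entropy I w (\<lambda>i. w i / S) = ennreal (\<Sum>i\<in>I. - (w i * ln (w i / S)))"
    "0 \<le> (\<Sum>i\<in>I. - (w i * ln (w i / S)))"
    using cross_entropy_real[of I w "\<lambda>i. w i / S"] fin w q S by auto
  have "cross_entropy I w (\<lambda>i. w i / S) \<le> cross_entropy I w c \<and>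
    (cross_entropy I w c \<le> cross_entropy I w (\<lambda>i. w i / S) \<longrightarrow> (\<forall>i\<in>I. c i = w i / S))"
  \<comment> \<open>An output 0 at a positive weight makes the cross entropy of \<open>c\<close>
    infinite, whereas that of \<open>w i / S\<close> is finite.\<close>
  proof (cases "\<exists>i\<in>I. 0 < w i \<and> c i = 0")
    case True
    then have "cross_entropy I w c = \<infinity>"
      using cross_entropy_eq_top[of I w c] fin w c by auto
    then show ?thesis using Q by (auto simp: top_unique)
  next
    case False
    then have ac: "\<And>i. i \<in> I \<Longrightarrow> 0 < w i \<Longrightarrow> 0 < c i"
      using c by (metis less_eq_real_def)
    have C: "cross_entropy I w c = ennreal (\<Sum>i\<in>I. - (w i * ln (c i)))"
      "0 \<le> (\<Sum>i\<in>I. - (w i * ln (c i)))"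
      using cross_entropy_real[of I w c] fin w c ac by auto
    \<comment> \<open>The nonnegative gap in \<open>gibbs_term\<close>; its sum is the difference of
      the two cross entropies.\<close>
    define d where "d i = w i * (ln (w i / S) - ln (c i)) - (w i - S * c i)" for i
    have d: "0 \<le> d i" if "i \<in> I" for i
      using gibbs_term(1)[of "w i" "c i" S] w c ac S that by (auto simp: d_def)
    have "(\<Sum>i\<in>I. d i) = (\<Sum>i\<in>I. - (w i * ln (c i))) - (\<Sum>i\<in>I. - (w i * ln (w i / S)))
        - (\<Sum>i\<in>I. w i - S * c i)"
      by (simp add: d_def sum_subtractf[symmetric] right_diff_distrib algebra_simps)
    moreover have "(\<Sum>i\<in>I. w i - S * c i) = 0"
      using c S by (simp add: sum_subtractf sum_distrib_left[symmetric])
    ultimately have sum_d: "(\<Sum>i\<in>I. d i) = (\<Sum>i\<in>I. - (w i * ln (c i))) - (\<Sum>i\<in>I. - (w i * ln (w i / S)))"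
      by simp
    have "0 \<le> (\<Sum>i\<in>I. d i)" using d by (rule sum_nonneg)
    then have 1: "cross_entropy I w (\<lambda>i. w i / S) \<le> cross_entropy I w c"
      unfolding C Q sum_d by (intro ennreal_leI) linarith
    have "c i = w i / S" if le: "cross_entropy I w c \<le> cross_entropy I w (\<lambda>i. w i / S)"
      and i: "i \<in> I" for i
    proof -
      have "(\<Sum>i\<in>I. d i) \<le> 0" using le unfolding C(1) Q(1) sum_d
        using Q(2) C(2) by (subst (asm) ennreal_le_iff) auto
      then have "(\<Sum>i\<in>I. d i) = 0" using d by (simp add: order.antisym sum_nonneg)
      then have "d i = 0" using d i fin by (simp add: sum_nonneg_eq_0_iff)
      then show ?thesis
        using gibbs_term(2)[of "w i" "c i" S] w c ac S i by (auto simp: d_def)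
    qed
    with 1 show ?thesis by auto
  qed
  then show "cross_entropy I w (\<lambda>i. w i / S) \<le> cross_entropy I w c"
    and "cross_entropy I w c \<le> cross_entropy I w (\<lambda>i. w i / S) \<Longrightarrow> i \<in> I \<Longrightarrow> c i = w i / S"
    by auto
qed

text \<open>Gibbs' inequality against the uniform vector, whose cross entropy is
  \<open>S * ln (card I)\<close>. The bound is linear in the total weight, so integrable weights
  have an integrable entropy.\<close>

lemma entropy_le:
  fixes w :: "'i \<Rightarrow> real"
  assumes fin: "finite I" and w: "\<And>i. i \<in> I \<Longrightarrow> 0 \<le> w i" and S: "S = (\<Sum>i\<in>I. w i)"
  shows "cross_entropy I w (\<lambda>i. w i / S) \<le> ennreal (S * ln (real (card I)))"
proof (cases "S = 0")
  case True
  then have "\<And>i. i \<in> I \<Longrightarrow> w i = 0" using S fin w by (simp add: sum_nonneg_eq_0_iff)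
  then show ?thesis by (simp add: cross_entropy_def)
next
  case False
  then have S0: "0 < S" using S w by (metis less_eq_real_def sum_nonneg)
  have I: "0 < card I" using False S fin by (auto simp: card_gt_0_iff)
  let ?u = "\<lambda>i::'i. 1 / real (card I)"
  have "cross_entropy I w (\<lambda>i. w i / S) \<le> cross_entropy I w ?u"
    using I by (intro gibbs(1)[OF fin w _ _ S S0]) auto
  also have "\<dots> = ennreal (\<Sum>i\<in>I. - (w i * ln (?u i)))"
    using I by (intro cross_entropy_real(1)[OF fin w]) auto
  also have "(\<Sum>i\<in>I. - (w i * ln (?u i))) = S * ln (real (card I))"
    using I by (simp add: S ln_div sum_distrib_right)
  finally show ?thesis .
qed

section \<open>Logarithmic integrals and KL divergence in terms of Lebesgue densities\<close>

definition cross_nll :: "('a::euclidean_space \<Rightarrow> real) \<Rightarrow> ('a \<Rightarrow> real) \<Rightarrow> ennreal" where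
  "cross_nll p f = (\<integral>\<^sup>+x. ennreal (p x) * neg_log (f x) \<partial>lborel)"

text \<open>A finite integral has an integrand finite almost everywhere, which excludes
  \<open>f x \<le> 0\<close> where \<open>0 < p x\<close>. Since \<open>f x \<le> 1\<close>, the
  integrand is then the nonnegative \<open>- (p x * ln (f x))\<close>, and finiteness means
  integrability. Positivity is a separate condition because \<open>ln 0 = 0\<close> would hide
  infinite values.\<close>

lemma cross_nll_finite_iff:
  fixes p f :: "'a::euclidean_space \<Rightarrow> real"
  assumes [measurable]: "p \<in> borel_measurable borel" "f \<in> borel_measurable borel"
    and p: "\<And>x. 0 \<le> p x" and f: "\<And>x. f x \<le> 1"
  shows "cross_nll p f < \<infinity> \<longleftrightarrow>
           (AE x in lborel. 0 < p x \<longrightarrow> 0 < f x) \<and> integrable lborel (\<lambda>x. p x * ln (f x))"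
    and "cross_nll p f < \<infinity> \<Longrightarrow> cross_nll p f = ennreal (- (\<integral>x. p x * ln (f x) \<partial>lborel))"
    and "cross_nll p f < \<infinity> \<Longrightarrow> (\<integral>x. p x * ln (f x) \<partial>lborel) \<le> 0"
proof -
  have eq: "ennreal (p x) * neg_log (f x) = ennreal (- (p x * ln (f x)))"
    and nonneg: "0 \<le> - (p x * ln (f x))" if "0 < p x \<longrightarrow> 0 < f x" for x
    using that p[of x] f[of x]
    by (cases "p x = 0"; simp add: neg_log_def ennreal_mult[symmetric] mult_nonneg_nonpos)+
  have ac: "AE x in lborel. 0 < p x \<longrightarrow> 0 < f x" if "cross_nll p f < \<infinity>"
  proof -
    have "AE x in lborel. ennreal (p x) * neg_log (f x) \<noteq> \<infinity>"
      using that by (intro nn_integral_PInf_AE) (auto simp: cross_nll_def)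
    then show ?thesis
      by eventually_elim (auto simp: neg_log_def ennreal_mult_eq_top_iff not_le[symmetric])
  qed
  have int: "cross_nll p f = (\<integral>\<^sup>+x. ennreal (- (p x * ln (f x))) \<partial>lborel)"
    if "AE x in lborel. 0 < p x \<longrightarrow> 0 < f x"
    unfolding cross_nll_def by (rule nn_integral_cong_AE) (use that in eventually_elim, simp add: eq)
  have nonneg_AE: "AE x in lborel. 0 \<le> - (p x * ln (f x))"
    if "AE x in lborel. 0 < p x \<longrightarrow> 0 < f x"
    using that by eventually_elim (rule nonneg)
  have neg: "integrable lborel (\<lambda>x. p x * ln (f x)) \<longleftrightarrow> integrable lborel (\<lambda>x. - (p x * ln (f x)))"
    by simp
  have integrable_iff_nonneg: "integrable lborel h \<longleftrightarrow> (\<integral>\<^sup>+x. ennreal (h x) \<partial>lborel) < \<infinity>"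
    if [measurable]: "h \<in> borel_measurable borel" and "AE x in lborel. 0 \<le> h x" for h :: "'a \<Rightarrow> real"
  proof
    show "(\<integral>\<^sup>+x. ennreal (h x) \<partial>lborel) < \<infinity>" if "integrable lborel h"
      using nn_integral_eq_integral[OF that] \<open>AE x in lborel. 0 \<le> h x\<close> by simp
    show "integrable lborel h" if "(\<integral>\<^sup>+x. ennreal (h x) \<partial>lborel) < \<infinity>"
      using \<open>AE x in lborel. 0 \<le> h x\<close> that by (intro integrableI_nonneg) auto
  qed
  show iff: "cross_nll p f < \<infinity> \<longleftrightarrow>
           (AE x in lborel. 0 < p x \<longrightarrow> 0 < f x) \<and> integrable lborel (\<lambda>x. p x * ln (f x))"
  proof (cases "AE x in lborel. 0 < p x \<longrightarrow> 0 < f x")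
    case True
    have "integrable lborel (\<lambda>x. - (p x * ln (f x))) \<longleftrightarrow> cross_nll p f < \<infinity>"
      unfolding int[OF True] by (rule integrable_iff_nonneg) (use nonneg_AE[OF True] in auto)
    then show ?thesis using True neg by blast
  qed (use ac in auto)
  show "cross_nll p f = ennreal (- (\<integral>x. p x * ln (f x) \<partial>lborel))" if "cross_nll p f < \<infinity>"
  proof -
    have "integrable lborel (\<lambda>x. - (p x * ln (f x)))" using that iff neg by blast
    then show ?thesis
      unfolding int[OF ac[OF that]] using nonneg_AE[OF ac[OF that]]
      by (subst nn_integral_eq_integral) simp_all
  qed
  show "(\<integral>x. p x * ln (f x) \<partial>lborel) \<le> 0" if "cross_nll p f < \<infinity>"
    using integral_nonneg_AE[OF nonneg_AE[OF ac[OF that]]] by simp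
qed

text \<open>If \<open>g\<close> vanishes almost everywhere that \<open>f\<close> does, then
  \<open>g / f\<close> is a density of the one measure with respect to the other, and by uniqueness
  it is the Radon-Nikodym derivative. Otherwise the zero set of \<open>f\<close> refutes absolute
  continuity.\<close>

lemma KL_density:
  fixes f g :: "'a::euclidean_space \<Rightarrow> real"
  assumes [measurable]: "f \<in> borel_measurable borel" "g \<in> borel_measurable borel"
    and f: "\<And>x. 0 \<le> f x" and g: "\<And>x. 0 \<le> g x"
    and fin: "(\<integral>\<^sup>+x. ennreal (f x) \<partial>lborel) = 1"
  shows "KL (density lborel g) (density lborel f) =
    (if (AE x in lborel. f x = 0 \<longrightarrow> g x = 0) \<and> integrable lborel (\<lambda>x. g x * ln (g x / f x))
     then ereal (\<integral>x. g x * ln (g x / f x) \<partial>lborel) else \<infinity>)"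
proof (cases "AE x in lborel. f x = 0 \<longrightarrow> g x = 0")
  case True
  let ?Q = "density lborel f" and ?P = "density lborel g"
  \<comment> \<open>At points with \<open>f x = 0\<close> the quotient is 0, but almost everywhere
    there \<open>g x = 0\<close>, so \<open>f x * (g x / f x) = g x\<close> still holds.\<close>
  have P: "?P = density ?Q (\<lambda>x. g x / f x)"
    using True f g by (auto simp: density_density_eq ennreal_mult[symmetric]
        intro!: density_cong elim!: eventually_mono)
  have ac: "absolutely_continuous ?Q ?P"
    unfolding P by (rule absolutely_continuousI_density) simp
  interpret Q: prob_space ?Q
    by standard (simp add: emeasure_density fin)
  have "AE x in ?Q. ennreal (g x / f x) = RN_deriv ?Q ?P x"
    unfolding P by (rule Q.RN_deriv_unique) auto
  \<comment> \<open>The entropy density is integrated against \<open>g\<close>, so the equality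
    matters only where \<open>0 < g x\<close>, that is, almost everywhere in
    \<open>?P\<close>.\<close>
  then have "AE x in ?P. ennreal (g x / f x) = RN_deriv ?Q ?P x"
    by (rule absolutely_continuous_AE[OF _ ac, rotated]) simp
  then have RN: "AE x in lborel. 0 < g x \<longrightarrow> ennreal (g x / f x) = RN_deriv ?Q ?P x"
    by (simp add: AE_density)
  have "AE x in lborel. g x * entropy_density (exp 1) ?Q ?P x = g x * ln (g x / f x)"
    using RN
  proof eventually_elim
    case (elim x)
    show ?case
    proof (cases "g x = 0")
      case False
      then have "RN_deriv ?Q ?P x = ennreal (g x / f x)" using elim g[of x] by simp
      then show ?thesis using f g by (simp add: entropy_density_def log_def)
    qed simp
  qed
  moreover have [measurable]: "entropy_density (exp 1) ?Q ?P \<in> borel_measurable borel"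
    using borel_measurable_RN_deriv[of ?Q ?P] unfolding entropy_density_def by simp
  ultimately have "integrable lborel (\<lambda>x. g x * entropy_density (exp 1) ?Q ?P x) \<longleftrightarrow>
      integrable lborel (\<lambda>x. g x * ln (g x / f x))"
    "(\<integral>x. g x * entropy_density (exp 1) ?Q ?P x \<partial>lborel) = (\<integral>x. g x * ln (g x / f x) \<partial>lborel)"
    by (intro integrable_cong_AE integral_cong_AE; measurable)+
  then have "integrable ?P (entropy_density (exp 1) ?Q ?P) \<longleftrightarrow> integrable lborel (\<lambda>x. g x * ln (g x / f x))"
    "integral\<^sup>L ?P (entropy_density (exp 1) ?Q ?P) = (\<integral>x. g x * ln (g x / f x) \<partial>lborel)"
    using g by (simp_all add: integrable_density integral_density)
  then show ?thesis using True ac by (simp add: KL_def KL_divergence_def)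
next
  case False
  have "{x. f x = 0} \<in> null_sets (density lborel f)"
    by (subst null_sets_density_iff) auto
  moreover have "{x. f x = 0} \<notin> null_sets (density lborel g)"
    using False g by (subst null_sets_density_iff) (auto simp: order.antisym elim!: eventually_mono)
  ultimately have "\<not> absolutely_continuous (density lborel f) (density lborel g)"
    by (auto simp: absolutely_continuous_def)
  with False show ?thesis by (simp add: KL_def)
qed

section \<open>Transformed densities and expectations over the mixture\<close>

lemma transformed_densitiesD:
  assumes "transformed_densities K T P p" "k \<in> {1..K}"
  shows "p k \<in> borel_measurable borel" "0 \<le> p k x" "distr P lborel (T k) = density lborel (p k)"
    "(\<integral>\<^sup>+x. ennreal (p k x) \<partial>lborel) = 1"
proof -
  from assms have nn: "\<And>x. 0 \<le> p k x" and d: "distributed P lborel (T k) (\<lambda>x. ennreal (p k x))"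
    and P: "prob_space P"
    by (auto simp: transformed_densities_def)
  show "0 \<le> p k x" by (rule nn)
  show m: "p k \<in> borel_measurable borel"
    using distributed_real_measurable[OF _ d] nn by simp
  show eq: "distr P lborel (T k) = density lborel (p k)"
    using d by (simp add: distributed_def)
  interpret D: prob_space "distr P lborel (T k)"
    using d P by (intro prob_space.prob_space_distr) (auto simp: distributed_def)
  show "(\<integral>\<^sup>+x. ennreal (p k x) \<partial>lborel) = 1"
    using D.emeasure_space_1 m unfolding eq by (simp add: emeasure_density)
qed

lemma nn_integral_sum_neg_log:
  fixes p c :: "'i \<Rightarrow> 'a::euclidean_space \<Rightarrow> real"
  assumes "\<And>k. k \<in> I \<Longrightarrow> p k \<in> borel_measurable borel"
    and "\<And>k. k \<in> I \<Longrightarrow> c k \<in> borel_measurable borel"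
  shows "(\<integral>\<^sup>+x. (\<Sum>k\<in>I. ennreal (p k x) * neg_log (c k x)) \<partial>lborel) = (\<Sum>k\<in>I. cross_nll (p k) (c k))"
  unfolding cross_nll_def
proof (rule nn_integral_sum)
  fix k assume "k \<in> I"
  note [measurable] = assms[OF this]
  show "(\<lambda>x. ennreal (p k x) * neg_log (c k x)) \<in> borel_measurable lborel" by measurable
qed

text \<open>By Bayes' rule the mixture density times the posterior of class \<open>k\<close> is
  \<open>p k x / K\<close>, so the nested expectation is an average over \<open>k\<close> of
  expectations under \<open>p k\<close>.\<close>

lemma mixture_expect_log_eq:
  fixes p c :: "nat \<Rightarrow> 'a::euclidean_space \<Rightarrow> real"
  assumes K: "1 \<le> K"
    and p [measurable]: "\<And>k. k \<in> {1..K} \<Longrightarrow> p k \<in> borel_measurable borel"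
    and nonneg: "\<And>k x. k \<in> {1..K} \<Longrightarrow> 0 \<le> p k x"
    and c [measurable]: "\<And>k. k \<in> {1..K} \<Longrightarrow> c k \<in> borel_measurable borel"
  shows "mixture_expect_log K p c = - enn2ereal (ennreal (1 / real K) * (\<Sum>k=1..K. cross_nll (p k) (c k)))"
proof -
  have "ennreal (mixture_density K p x) * (\<Sum>k=1..K. ennreal (posterior K p k x) * neg_log (c k x)) =
    ennreal (1 / real K) * (\<Sum>k=1..K. ennreal (p k x) * neg_log (c k x))" for x
  proof -
    have m: "0 \<le> mixture_density K p x"
      unfolding mixture_density_def using nonneg by (intro sum_nonneg mult_nonneg_nonneg) auto
    have "ennreal (mixture_density K p x) * ennreal (posterior K p k x) = ennreal (1 / real K) * ennreal (p k x)"
      if k: "k \<in> {1..K}" for k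
    proof -
      \<comment> \<open>Where the mixture density is 0 every \<open>p k x\<close> is 0, so the
        default value of the posterior does no harm.\<close>
      have "p k x = 0" if "mixture_density K p x = 0"
        using that nonneg k K unfolding mixture_density_def
        by (subst (asm) sum_nonneg_eq_0_iff) auto
      then have "mixture_density K p x * posterior K p k x = 1 / real K * p k x"
        by (cases "mixture_density K p x = 0") (auto simp: posterior_def)
      moreover have "0 \<le> posterior K p k x"
        using m nonneg[OF k] by (simp add: posterior_def)
      ultimately show ?thesis using m nonneg[OF k] by (simp add: ennreal_mult[symmetric])
    qed
    then show ?thesis
      unfolding sum_distrib_left by (intro sum.cong) (auto simp: mult.assoc[symmetric])
  qed
  moreover have "(\<lambda>x. \<Sum>k=1..K. ennreal (p k x) * neg_log (c k x)) \<in> borel_measurable lborel"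
    by measurable
  ultimately show ?thesis
    using nn_integral_sum_neg_log[of "{1..K}" p c, OF p c] unfolding mixture_expect_log_def
    by (simp add: nn_integral_cmult)
qed

section \<open>The optimal classifier\<close>

definition class_weight ::
  "nat \<Rightarrow> (nat \<Rightarrow> 'a \<Rightarrow> real) \<Rightarrow> (nat \<Rightarrow> 'a \<Rightarrow> real) \<Rightarrow> nat \<Rightarrow> 'a \<Rightarrow> real" where
  "class_weight K pd pg k x = (if k = K + 1 then \<Sum>j=1..K. pg j x else pd k x)"

context
  fixes K :: nat and pd pg :: "nat \<Rightarrow> 'a::euclidean_space \<Rightarrow> real"
  assumes K: "1 \<le> K"
    and pd_measurable [measurable]: "\<And>k. k \<in> {1..K} \<Longrightarrow> pd k \<in> borel_measurable borel"
    and pg_measurable [measurable]: "\<And>k. k \<in> {1..K} \<Longrightarrow> pg k \<in> borel_measurable borel"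
    and pd_nonneg: "\<And>k x. k \<in> {1..K} \<Longrightarrow> 0 \<le> pd k x"
    and pg_nonneg: "\<And>k x. k \<in> {1..K} \<Longrightarrow> 0 \<le> pg k x"
    and pd_prob: "\<And>k. k \<in> {1..K} \<Longrightarrow> (\<integral>\<^sup>+x. ennreal (pd k x) \<partial>lborel) = 1"
    and pg_prob: "\<And>k. k \<in> {1..K} \<Longrightarrow> (\<integral>\<^sup>+x. ennreal (pg k x) \<partial>lborel) = 1"
begin

private abbreviation (input) "W \<equiv> class_weight K pd pg"
private abbreviation (input) "S \<equiv> \<lambda>x. \<Sum>k=1..K+1. W k x"
private abbreviation (input) "D \<equiv> \<lambda>x. \<Sum>j=1..K. pd j x"
private abbreviation (input) "R \<equiv> \<lambda>x. \<Sum>j=1..K. pg j x"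

lemma D_nonneg: "0 \<le> D x" and ennreal_D: "ennreal (D x) = (\<Sum>k=1..K. ennreal (pd k x))"
  using pd_nonneg by (auto intro: sum_nonneg sum_ennreal[symmetric] simp del: sum_ennreal)

lemma R_nonneg: "0 \<le> R x" and ennreal_R: "ennreal (R x) = (\<Sum>k=1..K. ennreal (pg k x))"
  using pg_nonneg by (auto intro: sum_nonneg sum_ennreal[symmetric] simp del: sum_ennreal)

lemma class_weight_nonneg: "k \<in> {1..K+1} \<Longrightarrow> 0 \<le> W k x"
  using pd_nonneg pg_nonneg by (auto simp: class_weight_def intro!: sum_nonneg)

lemma class_weight_measurable [measurable]: "k \<in> {1..K+1} \<Longrightarrow> W k \<in> borel_measurable borel"
  by (cases "k = K + 1") (auto simp: class_weight_def[abs_def])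

lemma sum_class_weight: "S x = D x + R x"
  by (simp add: class_weight_def)

text \<open>In the fake term all \<open>K\<close> classes carry the same logarithm, that of
  \<open>C (K + 1)\<close>, so the \<open>pg k\<close> add up to a single weight for class
  \<open>K + 1\<close>. Maximizing \<open>Psi_plus\<close> thus becomes minimizing an integrated
  cross entropy.\<close>

lemma Psi_plus_eq:
  assumes C: "classifier K C"
  shows "Psi_plus K pd pg C =
    - enn2ereal (ennreal (1 / real K) *
        (\<integral>\<^sup>+x. cross_entropy {1..K+1} (\<lambda>k. W k x) (\<lambda>k. C k x) \<partial>lborel))"
proof -
  have [measurable]: "\<And>k. k \<in> {1..K+1} \<Longrightarrow> C k \<in> borel_measurable borel"
    using C by (simp add: classifier_def)
  have "cross_entropy {1..K+1} (\<lambda>k. W k x) (\<lambda>k. C k x) =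
      (\<Sum>k=1..K. ennreal (pd k x) * neg_log (C k x)) + (\<Sum>k=1..K. ennreal (pg k x) * neg_log (C (K + 1) x))" for x
    using ennreal_R[of x] by (simp add: cross_entropy_def class_weight_def sum_distrib_right)
  then have int: "(\<integral>\<^sup>+x. cross_entropy {1..K+1} (\<lambda>k. W k x) (\<lambda>k. C k x) \<partial>lborel) =
      (\<Sum>k=1..K. cross_nll (pd k) (C k)) + (\<Sum>k=1..K. cross_nll (pg k) (C (K + 1)))"
    using nn_integral_sum_neg_log[of "{1..K}" pd C] nn_integral_sum_neg_log[of "{1..K}" pg "\<lambda>_. C (K + 1)"]
    by (simp add: nn_integral_add)
  \<comment> \<open>Both summands lie in \<open>[-\<infinity>, 0]\<close>, so no
    \<open>\<infinity> - \<infinity>\<close> can occur.\<close>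
  have neg_add: "- enn2ereal a + - enn2ereal b = - enn2ereal (a + b)" for a b
    by (cases a; cases b) (auto simp: ennreal_plus[symmetric] enn2ereal_ennreal simp del: ennreal_plus)
  show ?thesis
    unfolding Psi_plus_def int distrib_left neg_add[symmetric]
    using mixture_expect_log_eq[where c = C, OF K pd_measurable pd_nonneg]
      mixture_expect_log_eq[where c = "\<lambda>_. C (K + 1)", OF K pg_measurable pg_nonneg]
    by simp
qed

text \<open>The competitor is the classifier that minimizes the cross entropy at every point. Its
  integral is finite, so an optimal \<open>C\<close>, which cannot have a larger one, attains the
  pointwise minimum almost everywhere, and the equality case of \<open>gibbs\<close> yields its
  values.\<close>

lemma optimal_classifier_AE:
  assumes opt: "optimal_classifier K pd pg C"
  shows "AE x in lborel. 0 < S x \<longrightarrow> (\<forall>k\<in>{1..K+1}. C k x = W k x / S x)"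
    and "(\<integral>\<^sup>+x. cross_entropy {1..K+1} (\<lambda>k. W k x) (\<lambda>k. C k x) \<partial>lborel) < \<infinity>"
proof -
  have C: "classifier K C" using opt by (simp add: optimal_classifier_def is_arg_max_def)
  have C_meas [measurable]: "\<And>k. k \<in> {1..K+1} \<Longrightarrow> C k \<in> borel_measurable borel"
    and C_nonneg: "\<And>k x. k \<in> {1..K+1} \<Longrightarrow> 0 \<le> C k x" and C_sum: "\<And>x. (\<Sum>k=1..K+1. C k x) = 1"
    using C by (auto simp: classifier_def)
  have S_nonneg: "0 \<le> S x" for x using class_weight_nonneg by (rule sum_nonneg)
  \<comment> \<open>Where \<open>S x = 0\<close> all weights vanish and every probability vector is
    a minimizer; putting all mass on class \<open>K + 1\<close> keeps the outputs nonnegative with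
    sum 1.\<close>
  define Q where "Q k x = (if 0 < S x then W k x / S x else if k = K + 1 then 1 else 0)" for k x
  have Q: "classifier K Q"
    unfolding classifier_def
  proof (intro conjI ballI allI)
    fix k assume k: "k \<in> {1..K+1}"
    show "Q k \<in> borel_measurable borel"
      using k unfolding Q_def[abs_def] by measurable
    show "0 \<le> Q k x" for x using k class_weight_nonneg[of k x] by (simp add: Q_def)
  next
    fix x show "(\<Sum>k=1..K+1. Q k x) = 1"
    proof (cases "0 < S x")
      case True
      then have "(\<Sum>k=1..K+1. Q k x) = (\<Sum>k=1..K+1. W k x / S x)" by (simp add: Q_def)
      also have "\<dots> = S x / S x" by (simp only: sum_divide_distrib)
      finally show ?thesis using True by simp
    qed (simp add: Q_def)
  qed
  let ?F = "\<lambda>C x. cross_entropy {1..K+1} (\<lambda>k. W k x) (\<lambda>k. C k x)"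
  have W0: "W k x = 0" if "\<not> 0 < S x" "k \<in> {1..K+1}" for k x
  proof -
    have "S x = 0" using that(1) S_nonneg[of x] by linarith
    then show ?thesis
      using that(2) class_weight_nonneg by (subst (asm) sum_nonneg_eq_0_iff) auto
  qed
  have F0: "?F C x = 0" if "\<not> 0 < S x" for C x
    using W0[OF that] by (simp add: cross_entropy_def)
  have FQ: "?F Q x = cross_entropy {1..K+1} (\<lambda>k. W k x) (\<lambda>k. W k x / S x)" if "0 < S x" for x
    using that by (simp add: Q_def)
  \<comment> \<open>Each of the \<open>2 * K\<close> densities has mass 1, so \<open>S\<close> has
    total mass \<open>2 * K\<close>.\<close>
  have S_int: "(\<integral>\<^sup>+x. ennreal (S x) \<partial>lborel) < \<infinity>"
  proof -
    have "(\<integral>\<^sup>+x. ennreal (S x) \<partial>lborel) =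
      (\<integral>\<^sup>+x. (\<Sum>k=1..K. ennreal (pd k x)) + (\<Sum>k=1..K. ennreal (pg k x)) \<partial>lborel)"
      unfolding sum_class_weight ennreal_plus[OF D_nonneg R_nonneg] ennreal_D ennreal_R ..
    also have "\<dots> = (\<Sum>k=1..K. \<integral>\<^sup>+x. ennreal (pd k x) \<partial>lborel) + (\<Sum>k=1..K. \<integral>\<^sup>+x. ennreal (pg k x) \<partial>lborel)"
      using nn_integral_sum[of "{1..K}" "\<lambda>k x. ennreal (pd k x)" lborel]
        nn_integral_sum[of "{1..K}" "\<lambda>k x. ennreal (pg k x)" lborel]
      by (subst nn_integral_add) auto
    also have "\<dots> = (\<Sum>k=1..K. 1) + (\<Sum>k=1..K. 1)"
      by (intro arg_cong2[where f = "(+)"] sum.cong refl pd_prob pg_prob)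
    finally show ?thesis by (simp add: of_nat_less_top)
  qed
  \<comment> \<open>The entropy bound for \<open>K + 1\<close> classes supplies the factor
    \<open>ln (K + 1)\<close>; where \<open>S x = 0\<close> the cross entropy is 0.\<close>
  have "(\<integral>\<^sup>+x. ?F Q x \<partial>lborel) \<le> (\<integral>\<^sup>+x. ennreal (ln (real (K + 1))) * ennreal (S x) \<partial>lborel)"
  proof (rule nn_integral_mono)
    fix x :: 'a
    show "?F Q x \<le> ennreal (ln (real (K + 1))) * ennreal (S x)"
    proof (cases "0 < S x")
      case True
      have "?F Q x \<le> ennreal (S x * ln (real (card {1..K+1})))"
        unfolding FQ[OF True] using class_weight_nonneg by (intro entropy_le) auto
      then show ?thesis using True by (simp add: ennreal_mult[symmetric] mult.commute)
    next
      case False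
      show ?thesis unfolding F0[OF False] by simp
    qed
  qed
  also have "\<dots> = ennreal (ln (real (K + 1))) * (\<integral>\<^sup>+x. ennreal (S x) \<partial>lborel)"
    by (rule nn_integral_cmult) measurable
  also have "\<dots> < \<infinity>"
    using S_int by (simp add: ennreal_mult_less_top)
  finally have FQ_fin: "(\<integral>\<^sup>+x. ?F Q x \<partial>lborel) < \<infinity>" .
  have "\<not> Psi_plus K pd pg C < Psi_plus K pd pg Q"
    using opt Q by (auto simp: optimal_classifier_def is_arg_max_def)
  then have "ennreal (1 / real K) * (\<integral>\<^sup>+x. ?F C x \<partial>lborel) \<le> ennreal (1 / real K) * (\<integral>\<^sup>+x. ?F Q x \<partial>lborel)"
    unfolding Psi_plus_eq[OF C] Psi_plus_eq[OF Q] by (simp add: less_eq_ennreal.rep_eq not_less)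
  then have le: "(\<integral>\<^sup>+x. ?F C x \<partial>lborel) \<le> (\<integral>\<^sup>+x. ?F Q x \<partial>lborel)"
    using K by (subst (asm) ennreal_mult_le_mult_iff) auto
  then show fin: "(\<integral>\<^sup>+x. ?F C x \<partial>lborel) < \<infinity>" using FQ_fin by (rule le_less_trans)
  have Q_meas [measurable]: "\<And>k. k \<in> {1..K+1} \<Longrightarrow> Q k \<in> borel_measurable borel"
    using Q by (simp add: classifier_def)
  have F_meas: "?F Q \<in> borel_measurable lborel" "?F C \<in> borel_measurable lborel"
    unfolding cross_entropy_def by measurable
  have mono: "?F Q x \<le> ?F C x" for x
  proof (cases "0 < S x")
    case True
    show ?thesis unfolding FQ[OF True]
      using class_weight_nonneg C_nonneg C_sum True by (intro gibbs(1)) auto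
  next
    case False
    show ?thesis unfolding F0[OF False] ..
  qed
  have "AE x in lborel. ?F C x \<le> ?F Q x"
  \<comment> \<open>As \<open>?F Q \<le> ?F C\<close> everywhere, a strict inequality on a set of
    positive measure would make the integrals strictly ordered. This relies on the integral for
    \<open>Q\<close> being finite.\<close>
  proof (rule ccontr)
    assume "\<not> ?thesis"
    then have "(\<integral>\<^sup>+x. ?F Q x \<partial>lborel) < (\<integral>\<^sup>+x. ?F C x \<partial>lborel)"
      using FQ_fin mono F_meas
      by (intro nn_integral_less) (auto simp only: infinity_ennreal_def less_irrefl intro: AE_I2)
    then show False using le by simp
  qed
  then show "AE x in lborel. 0 < S x \<longrightarrow> (\<forall>k\<in>{1..K+1}. C k x = W k x / S x)"
  proof eventually_elim
    case (elim x)
    show ?case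
    proof (intro impI ballI)
      fix k assume pos: "0 < S x" and k: "k \<in> {1..K+1}"
      show "C k x = W k x / S x"
        using gibbs(2)[of "{1..K+1}" "\<lambda>k. W k x" "\<lambda>k. C k x" "S x" k]
          class_weight_nonneg C_nonneg C_sum pos k elim[unfolded FQ[OF pos]] by auto
    qed
  qed
qed

section \<open>The generator's objective at an optimal classifier\<close>

lemma Phi_plus_optimal:
  assumes opt: "optimal_classifier K pd pg C" and agree: "posteriors_agree K pd pg"
  shows "Phi_plus K pg C =
    - (ereal (1 / real K) * (\<Sum>k=1..K. KL (density lborel (pg k)) (density lborel (pd k))))
    + ereal (1 / real K) * (\<Sum>k=1..K. expect_log (density lborel (pg k)) (\<lambda>x. pd k x / D x))"
proof -
  have C: "classifier K C" using opt by (simp add: optimal_classifier_def is_arg_max_def)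
  have C_meas [measurable]: "\<And>k. k \<in> {1..K+1} \<Longrightarrow> C k \<in> borel_measurable borel"
    and C_nonneg: "\<And>k x. k \<in> {1..K+1} \<Longrightarrow> 0 \<le> C k x" and C_sum: "\<And>x. (\<Sum>k=1..K+1. C k x) = 1"
    using C by (auto simp: classifier_def)
  have C_le: "C k x \<le> 1" if "k \<in> {1..K+1}" for k x
    by (rule prob_vector_le_1[of "{1..K+1}"]) (use C_nonneg C_sum that in blast)+
  have CK_meas [measurable]: "C (K + 1) \<in> borel_measurable borel" by (rule C_meas) simp
  have pd_le_D: "pd k x \<le> D x" if "k \<in> {1..K}" for k x
    using that pd_nonneg by (intro member_le_sum) auto
  have pg_le_R: "pg k x \<le> R x" if "k \<in> {1..K}" for k x
    using that pg_nonneg by (intro member_le_sum) auto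
  have ratio_le: "pd k x / D x \<le> 1" if "k \<in> {1..K}" for k x
    using pd_le_D[OF that, of x] D_nonneg[of x] by (cases "D x = 0") auto
  let ?e = "\<lambda>k x. pd k x / D x"
  let ?h = "\<lambda>k x. pg k x * ln (pg k x / pd k x)"
  \<comment> \<open>\<open>ac k\<close> expresses through densities that the generated law of class
    \<open>k\<close> is absolutely continuous with respect to the real one.\<close>
  define ac where "ac k \<longleftrightarrow> (AE x in lborel. pd k x = 0 \<longrightarrow> pg k x = 0)" for k
  have C_values: "AE x in lborel. 0 < D x + R x \<longrightarrow>
      C (K + 1) x = R x / (D x + R x) \<and> (\<forall>k\<in>{1..K}. C k x = pd k x / (D x + R x))"
    using optimal_classifier_AE(1)[OF opt] unfolding sum_class_weight
    by eventually_elim (auto simp: class_weight_def)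
  \<comment> \<open>The prior \<open>1 / K\<close> cancels in both posteriors.\<close>
  have agree': "AE x in lborel. 0 < D x \<and> 0 < R x \<longrightarrow> (\<forall>k\<in>{1..K}. pg k x / R x = pd k x / D x)"
    using agree K unfolding posteriors_agree_def
    by eventually_elim (auto simp: posterior_def mixture_density_def sum_divide_distrib[symmetric])
  \<comment> \<open>\<open>pg k\<close> is at most \<open>R\<close>, the weight of class
    \<open>K + 1\<close>, so the integrated cross entropy of \<open>C\<close>, which is finite, is
    an upper bound. Hence the expectation subtracted in \<open>Phi_plus\<close> is finite.\<close>
  have fake_finite: "cross_nll (pg k) (C (K + 1)) < \<infinity>" if k: "k \<in> {1..K}" for k
  proof -
    have "cross_nll (pg k) (C (K + 1)) \<le>
        (\<integral>\<^sup>+x. cross_entropy {1..K+1} (\<lambda>k. W k x) (\<lambda>k. C k x) \<partial>lborel)"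
      unfolding cross_nll_def
    proof (rule nn_integral_mono)
      fix x :: 'a
      have "ennreal (pg k x) * neg_log (C (K + 1) x) \<le> ennreal (W (K + 1) x) * neg_log (C (K + 1) x)"
        using pg_le_R[OF k] by (intro mult_right_mono ennreal_leI) (auto simp: class_weight_def)
      also have "\<dots> \<le> cross_entropy {1..K+1} (\<lambda>k. W k x) (\<lambda>k. C k x)"
        unfolding cross_entropy_def by (rule member_le_sum) auto
      finally show "ennreal (pg k x) * neg_log (C (K + 1) x) \<le> \<dots>" .
    qed
    then show ?thesis using optimal_classifier_AE(2)[OF opt] by (rule le_less_trans)
  qed
  have nll_C: "cross_nll (pg k) (C k) < \<infinity> \<longleftrightarrow>
        (AE x in lborel. 0 < pg k x \<longrightarrow> 0 < C k x) \<and> integrable lborel (\<lambda>x. pg k x * ln (C k x))"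
    if k: "k \<in> {1..K}" for k
    using k C_le pg_nonneg by (intro cross_nll_finite_iff(1)) auto
  \<comment> \<open>\<open>0 < pg k x\<close> gives \<open>0 < D x + R x\<close>, so
    \<open>C k x\<close> is the quotient \<open>pd k x / (D x + R x)\<close>.\<close>
  have pos_iff: "AE x in lborel. 0 < pg k x \<longrightarrow> (0 < C k x \<longleftrightarrow> pd k x \<noteq> 0)" if k: "k \<in> {1..K}" for k
    using C_values
  proof eventually_elim
    case (elim x)
    show ?case
      using elim k pd_nonneg[OF k, of x] pg_le_R[OF k, of x] D_nonneg[of x] by auto
  qed
  have ac_iff: "ac k \<longleftrightarrow> (AE x in lborel. 0 < pg k x \<longrightarrow> 0 < C k x)" if k: "k \<in> {1..K}" for k
    unfolding ac_def
  proof (rule eventually_subst)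
    show "AE x in lborel. (pd k x = 0 \<longrightarrow> pg k x = 0) = (0 < pg k x \<longrightarrow> 0 < C k x)"
      using pos_iff[OF k] by eventually_elim (use pg_nonneg[OF k] in \<open>auto simp: less_le\<close>)
  qed
  \<comment> \<open>Where \<open>pg k\<close> is positive, \<open>ac k\<close> makes
    \<open>pd k\<close> positive almost everywhere, so the posteriors agree and
    \<open>pd k x / D x\<close> is \<open>pg k x / R x\<close>. The entropy of these ratios is at
    most \<open>ln K * R x\<close>, and \<open>R\<close> has mass \<open>K\<close>.\<close>
  have entropy_finite: "cross_nll (pg k) (?e k) < \<infinity>" if ac: "\<And>j. j \<in> {1..K} \<Longrightarrow> ac j" and k: "k \<in> {1..K}" for k
  proof -
    have "AE x in lborel. \<forall>j\<in>{1..K}. pd j x = 0 \<longrightarrow> pg j x = 0"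
      using ac by (intro AE_finite_allI) (auto simp: ac_def)
    with agree' have "AE x in lborel. ennreal (pg k x) * neg_log (?e k x) \<le> ennreal (ln (real K)) * ennreal (R x)"
    proof eventually_elim
      case (elim x)
      show ?case
      proof (cases "pg k x = 0")
        case False
        then have "0 < pd k x" "0 < pg k x"
          using elim k pd_nonneg[OF k, of x] pg_nonneg[OF k, of x] by (auto simp: less_le)
        then have "0 < D x" "0 < R x" using pd_le_D[OF k, of x] pg_le_R[OF k, of x] by auto
        then have e: "?e k x = pg k x / R x" using elim k by auto
        have "ennreal (pg k x) * neg_log (pg k x / R x) \<le> cross_entropy {1..K} (\<lambda>j. pg j x) (\<lambda>j. pg j x / R x)"
          unfolding cross_entropy_def using k by (intro member_le_sum) auto
        also have "\<dots> \<le> ennreal (R x * ln (real (card {1..K})))"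
          using pg_nonneg by (intro entropy_le) auto
        also have "\<dots> = ennreal (ln (real K)) * ennreal (R x)"
          using K R_nonneg[of x] by (simp add: ennreal_mult[symmetric] mult.commute)
        finally show ?thesis unfolding e .
      qed simp
    qed
    then have "cross_nll (pg k) (?e k) \<le> (\<integral>\<^sup>+x. ennreal (ln (real K)) * ennreal (R x) \<partial>lborel)"
      unfolding cross_nll_def by (rule nn_integral_mono_AE)
    also have "\<dots> = ennreal (ln (real K)) * (\<integral>\<^sup>+x. ennreal (R x) \<partial>lborel)"
      by (rule nn_integral_cmult) measurable
    also have "(\<integral>\<^sup>+x. ennreal (R x) \<partial>lborel) = (\<Sum>k=1..K. \<integral>\<^sup>+x. ennreal (pg k x) \<partial>lborel)"
      unfolding ennreal_R by (rule nn_integral_sum) measurable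
    also have "\<dots> = (\<Sum>k=1..K. 1)"
      by (intro sum.cong refl pg_prob)
    also have "ennreal (ln (real K)) * \<dots> < \<infinity>"
      by (simp add: ennreal_mult_less_top of_nat_less_top)
    finally show ?thesis .
  qed
  have KL_eq: "KL (density lborel (pg k)) (density lborel (pd k)) =
      (if ac k \<and> integrable lborel (?h k) then ereal (\<integral>x. ?h k x \<partial>lborel) else \<infinity>)" if k: "k \<in> {1..K}" for k
    unfolding ac_def using k by (intro KL_density pd_measurable pg_measurable pd_nonneg pg_nonneg pd_prob)
  let ?lC = "\<lambda>k x. pg k x * ln (C k x)" and ?lF = "\<lambda>k x. pg k x * ln (C (K + 1) x)"
    and ?lE = "\<lambda>k x. pg k x * ln (?e k x)"
  \<comment> \<open>Where \<open>pg k\<close> is positive,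
    \<open>C (K + 1) / C k = R / pd k\<close>, and the factor \<open>pd k / D\<close> turns it into
    \<open>R / D\<close>, which is \<open>pg k / pd k\<close> by agreement of the posteriors.
    Elsewhere all terms are 0.\<close>
  have log_ratio_split: "AE x in lborel. ?h k x = ?lF k x + ?lE k x - ?lC k x" if ac: "ac k" and k: "k \<in> {1..K}" for k
    using ac[unfolded ac_def] C_values agree'
  proof eventually_elim
    case (elim x)
    show ?case
    proof (cases "pg k x = 0")
      case False
      then have pos: "0 < pd k x" "0 < pg k x"
        using elim pd_nonneg[OF k, of x] pg_nonneg[OF k, of x] by (auto simp: less_le)
      then have DR: "0 < D x" "0 < R x" using pd_le_D[OF k, of x] pg_le_R[OF k, of x] by auto
      have "ln (pg k x / R x) = ln (pd k x / D x)" using elim(3) DR k by auto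
      then have "ln (pg k x) - ln (R x) = ln (pd k x) - ln (D x)"
        using pos DR by (simp add: ln_div)
      moreover have "C (K + 1) x = R x / (D x + R x)" "C k x = pd k x / (D x + R x)"
        using elim(2) DR k by auto
      moreover have "0 < D x + R x" using DR by simp
      ultimately have "ln (pg k x / pd k x) = ln (C (K + 1) x) + ln (?e k x) - ln (C k x)"
        using pos DR by (simp add: ln_div)
      then show ?thesis by (simp only: distrib_left right_diff_distrib)
    qed simp
  qed
  have fake: "integrable lborel (?lF k)" if k: "k \<in> {1..K}" for k
    using cross_nll_finite_iff(1)[OF pg_measurable[OF k] CK_meas pg_nonneg[OF k] C_le]
      fake_finite[OF k] by simp
  have e_meas: "?e k \<in> borel_measurable borel" if [measurable]: "k \<in> {1..K}" for k
    by measurable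
  have entropy: "integrable lborel (?lE k)" if "\<And>j. j \<in> {1..K} \<Longrightarrow> ac j" and k: "k \<in> {1..K}" for k
    using cross_nll_finite_iff(1)[OF pg_measurable[OF k] e_meas[OF k] pg_nonneg[OF k] ratio_le[OF k]]
      entropy_finite[OF that] by simp
  \<comment> \<open>\<open>?h k\<close> and \<open>- ?lC k\<close> differ by the integrable
    \<open>?lF k + ?lE k\<close>, so they are integrable together.\<close>
  have int_iff: "integrable lborel (?lC k) \<longleftrightarrow> integrable lborel (?h k)"
    if ac: "\<And>j. j \<in> {1..K} \<Longrightarrow> ac j" and k: "k \<in> {1..K}" for k
  proof -
    note [measurable] = pd_measurable[OF k] pg_measurable[OF k] e_meas[OF k]
    have [measurable]: "C k \<in> borel_measurable borel" using k by (intro C_meas) auto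
    have "integrable lborel (?h k) \<longleftrightarrow> integrable lborel (\<lambda>x. ?lF k x + ?lE k x - ?lC k x)"
      using log_ratio_split[OF ac[OF k] k] by (intro integrable_cong_AE) measurable
    also have "\<dots> \<longleftrightarrow> integrable lborel (?lC k)"
    proof
      have FE: "integrable lborel (\<lambda>x. ?lF k x + ?lE k x)"
        by (rule Bochner_Integration.integrable_add[OF fake[OF k] entropy[OF that]])
      show "integrable lborel (\<lambda>x. ?lF k x + ?lE k x - ?lC k x)" if "integrable lborel (?lC k)"
        using FE that by (rule Bochner_Integration.integrable_diff)
      show "integrable lborel (?lC k)" if "integrable lborel (\<lambda>x. ?lF k x + ?lE k x - ?lC k x)"
        using Bochner_Integration.integrable_diff[OF FE that] by simp
    qed
    finally show ?thesis ..
  qed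
  have mix_C: "mixture_expect_log K pg C = - enn2ereal (ennreal (1 / real K) * (\<Sum>k=1..K. cross_nll (pg k) (C k)))"
    by (rule mixture_expect_log_eq[OF K pg_measurable pg_nonneg C_meas]) auto
  have mix_F: "mixture_expect_log K pg (\<lambda>_. C (K + 1)) =
      - enn2ereal (ennreal (1 / real K) * (\<Sum>k=1..K. cross_nll (pg k) (C (K + 1))))"
    by (rule mixture_expect_log_eq[OF K pg_measurable pg_nonneg CK_meas])
  have expect: "expect_log (density lborel (pg k)) (?e k) = - enn2ereal (cross_nll (pg k) (?e k))"
    if k: "k \<in> {1..K}" for k
    unfolding expect_log_def cross_nll_def
    using pg_measurable[OF k] e_meas[OF k] by (subst nn_integral_density) auto
  \<comment> \<open>Stated for a general \<open>c\<close> to serve both expectations in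
    \<open>Phi_plus\<close>: the class-wise outputs \<open>C\<close> and the constant family
    \<open>C (K + 1)\<close>.\<close>
  have average: "enn2ereal (ennreal (1 / real K) * (\<Sum>k=1..K. cross_nll (pg k) (c k))) =
      ereal (1 / real K * (\<Sum>k=1..K. - (\<integral>x. pg k x * ln (c k x) \<partial>lborel)))"
    if fin: "\<And>k. k \<in> {1..K} \<Longrightarrow> cross_nll (pg k) (c k) < \<infinity>"
      and c: "\<And>k. k \<in> {1..K} \<Longrightarrow> c k \<in> borel_measurable borel" "\<And>k x. k \<in> {1..K} \<Longrightarrow> c k x \<le> 1" for c
  proof -
    note L = cross_nll_finite_iff(2,3)[OF pg_measurable c(1) pg_nonneg c(2) fin]
    have "(\<Sum>k=1..K. cross_nll (pg k) (c k)) = (\<Sum>k=1..K. ennreal (- (\<integral>x. pg k x * ln (c k x) \<partial>lborel)))"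
      using L(1) by (intro sum.cong) auto
    also have "\<dots> = ennreal (\<Sum>k=1..K. - (\<integral>x. pg k x * ln (c k x) \<partial>lborel))"
      using L(2) by (intro sum_ennreal) auto
    finally have "ennreal (1 / real K) * (\<Sum>k=1..K. cross_nll (pg k) (c k)) =
        ennreal (1 / real K * (\<Sum>k=1..K. - (\<integral>x. pg k x * ln (c k x) \<partial>lborel)))"
      by (simp only: ennreal_mult' zero_le_divide_1_iff of_nat_0_le_iff)
    moreover have "0 \<le> (\<Sum>k=1..K. - (\<integral>x. pg k x * ln (c k x) \<partial>lborel))"
      using L(2) by (intro sum_nonneg) auto
    ultimately show ?thesis by (simp only: enn2ereal_ennreal mult_nonneg_nonneg zero_le_divide_1_iff of_nat_0_le_iff)
  qed
  have fake_average: "mixture_expect_log K pg (\<lambda>_. C (K + 1)) = ereal (1 / real K * (\<Sum>k=1..K. \<integral>x. ?lF k x \<partial>lborel))"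
    unfolding mix_F by (subst average) (use fake_finite C_le in \<open>auto simp: sum_negf\<close>)
  show ?thesis
  proof (cases "\<forall>k\<in>{1..K}. cross_nll (pg k) (C k) < \<infinity>")
    case True
    then have fin: "\<And>k. k \<in> {1..K} \<Longrightarrow> cross_nll (pg k) (C k) < \<infinity>" by blast
    then have ac: "\<And>k. k \<in> {1..K} \<Longrightarrow> ac k" and int_C: "\<And>k. k \<in> {1..K} \<Longrightarrow> integrable lborel (?lC k)"
      using nll_C ac_iff by blast+
    have KL: "KL (density lborel (pg k)) (density lborel (pd k)) =
       ereal ((\<integral>x. ?lF k x \<partial>lborel) + (\<integral>x. ?lE k x \<partial>lborel) - (\<integral>x. ?lC k x \<partial>lborel))" if k: "k \<in> {1..K}" for k
    proof -
      note [measurable] = pd_measurable[OF k] pg_measurable[OF k] e_meas[OF k]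
      have [measurable]: "C k \<in> borel_measurable borel" using k by (intro C_meas) auto
      have "(\<integral>x. ?h k x \<partial>lborel) = (\<integral>x. ?lF k x + ?lE k x - ?lC k x \<partial>lborel)"
        using log_ratio_split[OF ac[OF k] k] by (intro integral_cong_AE) measurable
      also have "\<dots> = (\<integral>x. ?lF k x \<partial>lborel) + (\<integral>x. ?lE k x \<partial>lborel) - (\<integral>x. ?lC k x \<partial>lborel)"
        using fake[OF k] entropy[OF ac k] int_C[OF k] by simp
      finally show ?thesis
        using KL_eq[OF k] ac[OF k] int_iff[OF ac k] int_C[OF k] by simp
    qed
    have E: "expect_log (density lborel (pg k)) (?e k) = ereal (\<integral>x. ?lE k x \<partial>lborel)" if k: "k \<in> {1..K}" for k
      using cross_nll_finite_iff(2,3)[OF pg_measurable[OF k] e_meas[OF k] pg_nonneg[OF k] ratio_le[OF k]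
          entropy_finite[OF ac k]] expect[OF k] by (simp add: enn2ereal_ennreal)
    have "mixture_expect_log K pg C = ereal (1 / real K * (\<Sum>k=1..K. \<integral>x. ?lC k x \<partial>lborel))"
      unfolding mix_C by (subst average) (use fin C_le in \<open>auto simp: sum_negf\<close>)
    \<comment> \<open>The \<open>?lE\<close> parts of the KL terms cancel against the
      \<open>expect_log\<close> terms, leaving the average of the integrals of \<open>?lC\<close>
      minus that of \<open>?lF\<close>.\<close>
    then show ?thesis
      unfolding Phi_plus_def fake_average
      using KL E by (simp add: sum.distrib sum_subtractf algebra_simps)
  next
    case False
    then obtain k where k: "k \<in> {1..K}" "cross_nll (pg k) (C k) = \<infinity>"
      by (auto simp: less_top[symmetric])
    then have "(\<Sum>k=1..K. cross_nll (pg k) (C k)) = \<infinity>"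
      using member_le_sum[of k "{1..K}" "\<lambda>k. cross_nll (pg k) (C k)"] by (simp add: top_unique)
    moreover have "ennreal (1 / real K) * \<infinity> = \<infinity>"
      using K by (simp add: ennreal_mult_top)
    ultimately have "mixture_expect_log K pg C = - \<infinity>"
      unfolding mix_C by (simp only:) simp
    \<comment> \<open>Subtracting the finite fake average from \<open>-\<infinity>\<close> leaves
      \<open>-\<infinity>\<close>.\<close>
    then have Phi: "Phi_plus K pg C = - \<infinity>"
      unfolding Phi_plus_def fake_average by simp
    \<comment> \<open>Were all KL terms finite, every \<open>ac j\<close> would hold and
      \<open>?h k\<close> would be integrable; then so would \<open>?lC k\<close>, contradicting the
      choice of \<open>k\<close>.\<close>
    have "\<exists>j\<in>{1..K}. KL (density lborel (pg j)) (density lborel (pd j)) = \<infinity>"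
    proof (rule ccontr)
      assume "\<not> ?thesis"
      then have "ac j \<and> integrable lborel (?h j)" if "j \<in> {1..K}" for j
        using KL_eq[OF that] that by (auto split: if_splits)
      then have "cross_nll (pg k) (C k) < \<infinity>"
        using nll_C[OF k(1)] ac_iff[OF k(1)] int_iff[OF _ k(1)] k(1) by blast
      then show False using k(2) by simp
    qed
    \<comment> \<open>No KL term is \<open>-\<infinity>\<close>, so a single infinite one makes the
      sum infinite; the \<open>expect_log\<close> sum is at most 0 and cannot compensate.\<close>
    moreover have "KL (density lborel (pg j)) (density lborel (pd j)) \<noteq> - \<infinity>" for j
      by (simp add: KL_def)
    ultimately have "(\<Sum>k=1..K. KL (density lborel (pg k)) (density lborel (pd k))) = \<infinity>"
      by (subst sum_Pinfty) auto
    moreover have "(\<Sum>k=1..K. expect_log (density lborel (pg k)) (?e k)) \<le> 0"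
      by (rule sum_nonpos) (simp add: expect_log_def)
    ultimately show ?thesis
      unfolding Phi using K
      by (cases "\<Sum>k=1..K. expect_log (density lborel (pg k)) (?e k)") auto
  qed
qed

end

section \<open>Equality of the two generator objectives and of their maximizers\<close>

theorem theorem2:
  fixes K :: nat
    and T :: "nat \<Rightarrow> 'a::euclidean_space \<Rightarrow> 'a"
    and Pd :: "'a measure" and pd :: "nat \<Rightarrow> 'a \<Rightarrow> real"
    and \<G> :: "'g set"
    and Pg :: "'g \<Rightarrow> 'a measure" and pg :: "'g \<Rightarrow> nat \<Rightarrow> 'a \<Rightarrow> real"
    and Cstar :: "'g \<Rightarrow> nat \<Rightarrow> 'a \<Rightarrow> real"
  assumes "K \<ge> 1"
    and "transformed_densities K T Pd pd"
    and "\<And>G. G \<in> \<G> \<Longrightarrow> transformed_densities K T (Pg G) (pg G)"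
    and optimal: "\<And>G. G \<in> \<G> \<Longrightarrow> optimal_classifier K pd (pg G) (Cstar G)"
    and equilibrium: "\<And>G. G \<in> \<G> \<Longrightarrow> posteriors_agree K pd (pg G)"
  shows "(\<forall>G\<in>\<G>. Phi_plus K (pg G) (Cstar G) = KL_objective K T Pd pd (Pg G)) \<and>
         (\<forall>G. is_arg_max (\<lambda>G. Phi_plus K (pg G) (Cstar G)) (\<lambda>G. G \<in> \<G>) G \<longleftrightarrow>
              is_arg_max (\<lambda>G. KL_objective K T Pd pd (Pg G)) (\<lambda>G. G \<in> \<G>) G)"
proof -
  have eq: "Phi_plus K (pg G) (Cstar G) = KL_objective K T Pd pd (Pg G)" if G: "G \<in> \<G>" for G
  proof -
    note d = transformed_densitiesD[OF assms(2)]
    note g = transformed_densitiesD[OF assms(3)[OF G]]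
    have "Phi_plus K (pg G) (Cstar G) =
        - (ereal (1 / real K) * (\<Sum>k=1..K. KL (density lborel (pg G k)) (density lborel (pd k))))
        + ereal (1 / real K) * (\<Sum>k=1..K. expect_log (density lborel (pg G k)) (\<lambda>x. pd k x / (\<Sum>j=1..K. pd j x)))"
      by (rule Phi_plus_optimal[OF assms(1) d(1) g(1) d(2) g(2) d(4) g(4) optimal[OF G] equilibrium[OF G]])
    then show ?thesis
      unfolding KL_objective_def by (simp add: d(3) g(3))
  qed
  \<comment> \<open>\<open>is_arg_max\<close> compares values of an objective only at members of
    \<open>\<G>\<close>, where the two objectives agree.\<close>
  then show ?thesis by (auto simp: is_arg_max_def)
qed

end
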